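(* Let $d\ge1$ and let $E$ be one of the spaces $C_{ub}(\mathbb{R}^d)$, $C_b(\mathbb{R}^d)$, $L^\infty(\mathbb{R}^d)$. Let $H:E\to E$ and $h,p,r>0$ be such that $$\|Hw-Hv\|_E\le h\|w-v\|_E,\qquad w,v\in E_r^+,$$ $$Hv+pv\le Hw+pw,\qquad v\le w,\ w,v\in E_r^+ .$$ Let $T>0$ be fixed. Suppose that $u_1,u_2\in C([0,T]\to E)\cap C^1((0,T]\to E)$ are such that $$0\le u_1(x,t),\qquad u_2(x,t)\le r,\qquad (x,t)\in\mathbb{R}^d\times(0,T],$$ $$(\mathcal F_ru_1)(x,t)\le(\mathcal F_ru_2)(x,t),\qquad (x,t)\in\mathbb{R}^d\times(0,T],$$ $$u_1(x,0)\le u_2(x,0),\qquad x\in\mathbb{R}^d .$$ Then $u_1(x,t)\le u_2(x,t)$ for all $(x,t)\in\mathbb{R}^d\times[0,T]$.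
   Context: $C_{ub}(\mathbb{R}^d)$ and $C_b(\mathbb{R}^d)$ are the spaces of bounded uniformly continuous, respectively bounded continuous, real functions with the sup-norm; $L^\infty(\mathbb{R}^d)$ has the esssup-norm. Inequalities between elements of $E$ are pointwise (a.e. if $E=L^\infty$). For $r>0$, $E_r^+:=\{v\in E:0\le v\le r\}$. For $u\in C([0,T]\to E)\cap C^1((0,T]\to E)$ and $r>0$, $$(\mathcal F_ru)(x,t):=\frac{\partial u}{\partial t}(x,t)-H(0\vee u\wedge r)(x,t),\qquad t\in(0,T],\ x\in\mathbb{R}^d,$$ where $(0\vee u\wedge r)(x,t)=\min\{\max\{u(x,t),0\},r\}$, $H$ acts in the variable $x$ for each fixed $t$, and the left derivative is taken at $t=T$. The bounds assumed on $u_1$ and $u_2$ are one-sided: a lower bound by $0$ for $u_1$ and an upper bound by $r$ for $u_2$. *)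

theory Defs
  imports "HOL-Analysis.Analysis" "HOL-Probability.Essential_Supremum"
begin

text \<open>
  Each of the three function spaces is a type carrying its norm (class \<^class>\<open>real_normed_vector\<close>),
  its pointwise (respectively almost everywhere) order (class \<^class>\<open>lattice\<close>), and the constant
  function 1 (class \<^class>\<open>one\<close>), so that the constant function with value \<open>r\<close> is \<open>r *\<^sub>R 1\<close>.
\<close>

section \<open>Bounded continuous functions\<close>

text \<open>The normed space is the library type \<^typ>\<open>'a \<Rightarrow>\<^sub>C 'b\<close>; only order and unit are missing.\<close>

setup_lifting type_definition_bcontfun

instantiation bcontfun :: (topological_space, "{metric_space, linorder_topology}") lattice
begin

lift_definition less_eq_bcontfun :: "('a \<Rightarrow>\<^sub>C 'b) \<Rightarrow> ('a \<Rightarrow>\<^sub>C 'b) \<Rightarrow> bool"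
  is "\<lambda>f g. \<forall>x. f x \<le> g x" .

definition less_bcontfun :: "('a \<Rightarrow>\<^sub>C 'b) \<Rightarrow> ('a \<Rightarrow>\<^sub>C 'b) \<Rightarrow> bool"
  where "less_bcontfun f g \<longleftrightarrow> f \<le> g \<and> \<not> g \<le> f"

lift_definition inf_bcontfun :: "('a \<Rightarrow>\<^sub>C 'b) \<Rightarrow> ('a \<Rightarrow>\<^sub>C 'b) \<Rightarrow> 'a \<Rightarrow>\<^sub>C 'b"
  is "\<lambda>f g x. min (f x) (g x)"
proof -
  fix f g :: "'a \<Rightarrow> 'b" assume "f \<in> bcontfun" "g \<in> bcontfun"
  moreover have "range (\<lambda>x. min (f x) (g x)) \<subseteq> range f \<union> range g"
    by (auto simp: min_def)
  ultimately show "(\<lambda>x. min (f x) (g x)) \<in> bcontfun"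
    unfolding bcontfun_def
    by (auto intro: continuous_on_min bounded_subset[where T = "range f \<union> range g"])
qed

lift_definition sup_bcontfun :: "('a \<Rightarrow>\<^sub>C 'b) \<Rightarrow> ('a \<Rightarrow>\<^sub>C 'b) \<Rightarrow> 'a \<Rightarrow>\<^sub>C 'b"
  is "\<lambda>f g x. max (f x) (g x)"
proof -
  fix f g :: "'a \<Rightarrow> 'b" assume "f \<in> bcontfun" "g \<in> bcontfun"
  moreover have "range (\<lambda>x. max (f x) (g x)) \<subseteq> range f \<union> range g"
    by (auto simp: max_def)
  ultimately show "(\<lambda>x. max (f x) (g x)) \<in> bcontfun"
    unfolding bcontfun_def
    by (auto intro: continuous_on_max bounded_subset[where T = "range f \<union> range g"])
qed

instance
proof
  fix f g k :: "'a \<Rightarrow>\<^sub>C 'b"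
  show "f < g \<longleftrightarrow> f \<le> g \<and> \<not> g \<le> f" by (rule less_bcontfun_def)
  show "f \<le> f" by transfer simp
  show "f \<le> g \<Longrightarrow> g \<le> k \<Longrightarrow> f \<le> k" by transfer (blast intro: order_trans)
  show "f \<le> g \<Longrightarrow> g \<le> f \<Longrightarrow> f = g" by transfer (auto intro: antisym)
  show "inf f g \<le> f" "inf f g \<le> g" "f \<le> sup f g" "g \<le> sup f g" by (transfer; simp)+
  show "f \<le> g \<Longrightarrow> f \<le> k \<Longrightarrow> f \<le> inf g k" by transfer simp
  show "g \<le> f \<Longrightarrow> k \<le> f \<Longrightarrow> sup g k \<le> f" by transfer simp
qed

end

instantiation bcontfun :: (topological_space, "{metric_space, one}") one
begin

definition one_bcontfun :: "'a \<Rightarrow>\<^sub>C 'b" where "one_bcontfun = const_bcontfun 1"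

instance ..

end

section \<open>Bounded uniformly continuous functions\<close>

typedef (overloaded) 'a buc =
  "{f :: 'a::metric_space \<Rightarrow>\<^sub>C real. uniformly_continuous_on UNIV (apply_bcontfun f)}"
  morphisms bcontfun_of_buc Buc
  by (rule exI[of _ 0]) (simp add: uniformly_continuous_on_const)

setup_lifting type_definition_buc

lemma uniformly_continuous_on_min_max:
  fixes f g :: "'a::metric_space \<Rightarrow> real"
  assumes "uniformly_continuous_on S f" "uniformly_continuous_on S g"
  shows "uniformly_continuous_on S (\<lambda>x. min (f x) (g x))"
    and "uniformly_continuous_on S (\<lambda>x. max (f x) (g x))"
proof -
  have "\<exists>d>0. \<forall>x\<in>S. \<forall>y\<in>S. dist y x < d \<longrightarrow> dist (f y) (f x) < e \<and> dist (g y) (g x) < e"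
    if e: "e > 0" for e
  proof -
    from assms(1) e obtain d1 where "d1 > 0" "\<forall>x\<in>S. \<forall>y\<in>S. dist y x < d1 \<longrightarrow> dist (f y) (f x) < e"
      unfolding uniformly_continuous_on_def by blast
    moreover from assms(2) e obtain d2
      where "d2 > 0" "\<forall>x\<in>S. \<forall>y\<in>S. dist y x < d2 \<longrightarrow> dist (g y) (g x) < e"
      unfolding uniformly_continuous_on_def by blast
    ultimately show ?thesis by (intro exI[of _ "min d1 d2"]) auto
  qed
  note * = this
  have "dist (min a b) (min a' b') < e" "dist (max a b) (max a' b') < e"
    if "dist a a' < e" "dist b b' < e" for a b a' b' e :: real
    using that by (auto simp: dist_real_def min_def max_def)
  with * show "uniformly_continuous_on S (\<lambda>x. min (f x) (g x))"
    "uniformly_continuous_on S (\<lambda>x. max (f x) (g x))"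
    unfolding uniformly_continuous_on_def by meson+
qed

instantiation buc :: (metric_space) real_vector
begin

lift_definition zero_buc :: "'a buc" is 0
  by (simp add: uniformly_continuous_on_const)
lift_definition uminus_buc :: "'a buc \<Rightarrow> 'a buc" is uminus
  by (simp add: uniformly_continuous_on_minus)
lift_definition plus_buc :: "'a buc \<Rightarrow> 'a buc \<Rightarrow> 'a buc" is "(+)"
  by (simp add: uniformly_continuous_on_add)
lift_definition minus_buc :: "'a buc \<Rightarrow> 'a buc \<Rightarrow> 'a buc" is "(-)"
  by (simp add: uniformly_continuous_on_diff)
lift_definition scaleR_buc :: "real \<Rightarrow> 'a buc \<Rightarrow> 'a buc" is "(*\<^sub>R)"
  by (auto dest: uniformly_continuous_on_cmul)

instance
proof
  fix f g k :: "'a buc" and a b :: real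
  show "f + g + k = f + (g + k)" "f + g = g + f" "0 + f = f" "- f + f = 0" "f - g = f + - g"
    by (transfer; simp)+
  show "a *\<^sub>R (f + g) = a *\<^sub>R f + a *\<^sub>R g" "(a + b) *\<^sub>R f = a *\<^sub>R f + b *\<^sub>R f"
    "a *\<^sub>R b *\<^sub>R f = (a * b) *\<^sub>R f" "1 *\<^sub>R f = f"
    by (transfer; simp add: algebra_simps)+
qed

end

instantiation buc :: (metric_space) real_normed_vector
begin

lift_definition norm_buc :: "'a buc \<Rightarrow> real" is norm .

definition dist_buc :: "'a buc \<Rightarrow> 'a buc \<Rightarrow> real"
  where "dist_buc f g = norm (f - g)"
definition sgn_buc :: "'a buc \<Rightarrow> 'a buc"
  where "sgn_buc f = f /\<^sub>R norm f"
definition uniformity_buc :: "('a buc \<times> 'a buc) filter"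
  where "uniformity_buc = (INF e\<in>{0<..}. principal {(x, y). dist x y < e})"
definition open_buc :: "'a buc set \<Rightarrow> bool"
  where "open_buc S = (\<forall>x\<in>S. \<forall>\<^sub>F (x', y) in uniformity. x' = x \<longrightarrow> y \<in> S)"

instance
proof
  fix f g :: "'a buc" and a :: real
  show "dist f g = norm (f - g)" by (rule dist_buc_def)
  show "sgn f = f /\<^sub>R norm f" by (rule sgn_buc_def)
  show "uniformity = (INF e\<in>{0<..}. principal {(x::'a buc, y). dist x y < e})"
    by (rule uniformity_buc_def)
  show "open S = (\<forall>x\<in>S. \<forall>\<^sub>F (x', y) in uniformity. x' = x \<longrightarrow> y \<in> S)" for S :: "'a buc set"
    by (rule open_buc_def)
  show "norm f = 0 \<longleftrightarrow> f = 0" "norm (a *\<^sub>R f) = \<bar>a\<bar> * norm f"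
    by (transfer; simp)+
  show "norm (f + g) \<le> norm f + norm g"
    by transfer (rule norm_triangle_ineq)
qed

end

instantiation buc :: (metric_space) "{lattice, one}"
begin

lift_definition less_eq_buc :: "'a buc \<Rightarrow> 'a buc \<Rightarrow> bool" is "(\<le>)" .
lift_definition less_buc :: "'a buc \<Rightarrow> 'a buc \<Rightarrow> bool" is "(<)" .
lift_definition inf_buc :: "'a buc \<Rightarrow> 'a buc \<Rightarrow> 'a buc" is inf
  by (simp add: inf_bcontfun.rep_eq uniformly_continuous_on_min_max)
lift_definition sup_buc :: "'a buc \<Rightarrow> 'a buc \<Rightarrow> 'a buc" is sup
  by (simp add: sup_bcontfun.rep_eq uniformly_continuous_on_min_max)
lift_definition one_buc :: "'a buc" is 1
  by (simp add: one_bcontfun_def uniformly_continuous_on_const)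

instance by standard (transfer; auto)+

end

section \<open>Essentially bounded functions\<close>

definition ess_bounded :: "('a::euclidean_space \<Rightarrow> real) \<Rightarrow> bool"
  where "ess_bounded f \<longleftrightarrow>
    f \<in> borel_measurable lebesgue \<and> (\<exists>C. AE x in lebesgue. \<bar>f x\<bar> \<le> C)"

definition ae_equal :: "('a::euclidean_space \<Rightarrow> real) \<Rightarrow> ('a \<Rightarrow> real) \<Rightarrow> bool"
  where "ae_equal f g \<longleftrightarrow>
    ess_bounded f \<and> ess_bounded g \<and> (AE x in lebesgue. f x = g x)"

quotient_type (overloaded) 'a linfty = "'a::euclidean_space \<Rightarrow> real" / partial: ae_equal
proof (rule part_equivpI)
  show "\<exists>f. ae_equal f (f :: 'a \<Rightarrow> real)"
    by (rule exI[of _ "\<lambda>_. 0"]) (auto simp: ae_equal_def ess_bounded_def)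
  show "symp (ae_equal :: ('a \<Rightarrow> real) \<Rightarrow> _)"
    by (auto simp: symp_def ae_equal_def elim: AE_mp)
  show "transp (ae_equal :: ('a \<Rightarrow> real) \<Rightarrow> _)"
    by (auto simp: transp_def ae_equal_def)
qed

lemma ess_bounded_const: "ess_bounded (\<lambda>_::'a::euclidean_space. c)"
  by (auto simp: ess_bounded_def)

lemma ess_bounded_binop:
  assumes "ess_bounded f" "ess_bounded g"
    and "(\<lambda>x. q (f x) (g x)) \<in> borel_measurable lebesgue"
    and "\<And>a b. \<bar>q a b\<bar> \<le> \<bar>a\<bar> + \<bar>b\<bar>"
  shows "ess_bounded (\<lambda>x. q (f x) (g x))"
proof -
  from assms obtain C D where "AE x in lebesgue. \<bar>f x\<bar> \<le> C" "AE x in lebesgue. \<bar>g x\<bar> \<le> D"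
    unfolding ess_bounded_def by blast
  then have "AE x in lebesgue. \<bar>q (f x) (g x)\<bar> \<le> C + D"
    by eventually_elim (use assms(4) in \<open>fastforce intro: order_trans add_mono\<close>)
  with assms(3) show ?thesis unfolding ess_bounded_def by blast
qed

lemma ess_bounded_add: "ess_bounded f \<Longrightarrow> ess_bounded g \<Longrightarrow> ess_bounded (\<lambda>x. f x + g x)"
  by (rule ess_bounded_binop) (auto simp: ess_bounded_def)

lemma ess_bounded_diff: "ess_bounded f \<Longrightarrow> ess_bounded g \<Longrightarrow> ess_bounded (\<lambda>x. f x - g x)"
  by (rule ess_bounded_binop) (auto simp: ess_bounded_def)

lemma ess_bounded_min: "ess_bounded f \<Longrightarrow> ess_bounded g \<Longrightarrow> ess_bounded (\<lambda>x. min (f x) (g x))"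
  by (rule ess_bounded_binop) (auto simp: ess_bounded_def)

lemma ess_bounded_max: "ess_bounded f \<Longrightarrow> ess_bounded g \<Longrightarrow> ess_bounded (\<lambda>x. max (f x) (g x))"
  by (rule ess_bounded_binop) (auto simp: ess_bounded_def)

lemma ess_bounded_cmult:
  assumes "ess_bounded f"
  shows "ess_bounded (\<lambda>x. c * f x)"
proof -
  from assms obtain C where "AE x in lebesgue. \<bar>f x\<bar> \<le> C"
    unfolding ess_bounded_def by blast
  then have "AE x in lebesgue. \<bar>c * f x\<bar> \<le> \<bar>c\<bar> * C"
    by eventually_elim (simp add: abs_mult mult_left_mono)
  with assms show ?thesis unfolding ess_bounded_def by auto
qed

lemma ess_bounded_uminus: "ess_bounded f \<Longrightarrow> ess_bounded (\<lambda>x. - f x)"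
  using ess_bounded_cmult[of f "-1"] by simp

text \<open>The essential supremum of \<open>\<bar>f\<bar>\<close> is taken in \<^typ>\<open>ereal\<close>; it is finite on \<open>L\<^sup>\<infinity>\<close>.\<close>

definition ess_norm :: "('a::euclidean_space \<Rightarrow> real) \<Rightarrow> real"
  where "ess_norm f = real_of_ereal (esssup lebesgue (\<lambda>x. ereal \<bar>f x\<bar>))"

lemma ereal_ess_norm:
  assumes "ess_bounded f"
  shows "ereal (ess_norm f) = esssup lebesgue (\<lambda>x. ereal \<bar>f x\<bar>)" "0 \<le> ess_norm f"
proof -
  have [measurable]: "f \<in> borel_measurable lebesgue"
    using assms by (simp add: ess_bounded_def)
  obtain C where C: "AE x in lebesgue. \<bar>f x\<bar> \<le> C"
    using assms unfolding ess_bounded_def by blast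
  let ?s = "esssup lebesgue (\<lambda>x. ereal \<bar>f x\<bar>)"
  have up: "?s \<le> ereal C" using C by (intro esssup_I) auto
  have "esssup lebesgue (\<lambda>x::'a. 0::ereal) \<le> ?s" by (rule esssup_mono) auto
  then have lo: "0 \<le> ?s" by (subst (asm) esssup_const) auto
  show "ereal (ess_norm f) = ?s"
    using up lo unfolding ess_norm_def by (cases ?s) auto
  show "0 \<le> ess_norm f"
    using lo unfolding ess_norm_def by (rule real_of_ereal_pos)
qed

lemma AE_le_ess_norm:
  assumes "ess_bounded f"
  shows "AE x in lebesgue. \<bar>f x\<bar> \<le> ess_norm f"
  using esssup_AE[of "\<lambda>x. ereal \<bar>f x\<bar>" lebesgue] by (simp flip: ereal_ess_norm(1)[OF assms])

lemma ess_norm_le: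
  assumes "ess_bounded f" "AE x in lebesgue. \<bar>f x\<bar> \<le> C"
  shows "ess_norm f \<le> C"
proof -
  have [measurable]: "f \<in> borel_measurable lebesgue"
    using assms by (simp add: ess_bounded_def)
  have "esssup lebesgue (\<lambda>x. ereal \<bar>f x\<bar>) \<le> ereal C"
    using assms(2) by (intro esssup_I) auto
  then show ?thesis by (simp flip: ereal_ess_norm(1)[OF assms(1)])
qed

instantiation linfty :: (euclidean_space) real_vector
begin

lift_definition zero_linfty :: "'a linfty" is "\<lambda>_. 0"
  by (simp add: ae_equal_def ess_bounded_const)
lift_definition uminus_linfty :: "'a linfty \<Rightarrow> 'a linfty" is "\<lambda>f x. - f x"
  by (auto simp: ae_equal_def ess_bounded_uminus)
lift_definition plus_linfty :: "'a linfty \<Rightarrow> 'a linfty \<Rightarrow> 'a linfty" is "\<lambda>f g x. f x + g x"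
  unfolding ae_equal_def by (auto simp: ess_bounded_add elim: eventually_elim2)
lift_definition minus_linfty :: "'a linfty \<Rightarrow> 'a linfty \<Rightarrow> 'a linfty" is "\<lambda>f g x. f x - g x"
  unfolding ae_equal_def by (auto simp: ess_bounded_diff elim: eventually_elim2)
lift_definition scaleR_linfty :: "real \<Rightarrow> 'a linfty \<Rightarrow> 'a linfty" is "\<lambda>c f x. c * f x"
  by (auto simp: ae_equal_def ess_bounded_cmult)

instance
proof
  fix f g k :: "'a linfty" and a b :: real
  show "f + g + k = f + (g + k)" "f + g = g + f" "0 + f = f" "- f + f = 0" "f - g = f + - g"
    by (transfer; simp add: ae_equal_def ess_bounded_add ess_bounded_diff ess_bounded_uminus
        ess_bounded_const algebra_simps)+
  show "a *\<^sub>R (f + g) = a *\<^sub>R f + a *\<^sub>R g" "(a + b) *\<^sub>R f = a *\<^sub>R f + b *\<^sub>R f"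
    "a *\<^sub>R b *\<^sub>R f = (a * b) *\<^sub>R f" "1 *\<^sub>R f = f"
    by (transfer; auto simp: ae_equal_def ess_bounded_cmult algebra_simps
        intro!: ess_bounded_add ess_bounded_cmult)+
qed

end

instantiation linfty :: (euclidean_space) real_normed_vector
begin

lift_definition norm_linfty :: "'a linfty \<Rightarrow> real" is ess_norm
proof -
  fix f g :: "'a \<Rightarrow> real" assume fg: "ae_equal f g"
  have [measurable]: "f \<in> borel_measurable lebesgue" "g \<in> borel_measurable lebesgue"
    using fg by (auto simp: ae_equal_def ess_bounded_def)
  have "AE x in lebesgue. ereal \<bar>f x\<bar> = ereal \<bar>g x\<bar>"
    using fg by (auto simp: ae_equal_def)
  then show "ess_norm f = ess_norm g"
    unfolding ess_norm_def by (subst esssup_AE_cong[where g = "\<lambda>x. ereal \<bar>g x\<bar>"]) auto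
qed

definition dist_linfty :: "'a linfty \<Rightarrow> 'a linfty \<Rightarrow> real"
  where "dist_linfty f g = norm (f - g)"
definition sgn_linfty :: "'a linfty \<Rightarrow> 'a linfty"
  where "sgn_linfty f = f /\<^sub>R norm f"
definition uniformity_linfty :: "('a linfty \<times> 'a linfty) filter"
  where "uniformity_linfty = (INF e\<in>{0<..}. principal {(x, y). dist x y < e})"
definition open_linfty :: "'a linfty set \<Rightarrow> bool"
  where "open_linfty S = (\<forall>x\<in>S. \<forall>\<^sub>F (x', y) in uniformity. x' = x \<longrightarrow> y \<in> S)"

instance
proof
  fix f g :: "'a linfty" and a :: real
  show "dist f g = norm (f - g)" by (rule dist_linfty_def)
  show "sgn f = f /\<^sub>R norm f" by (rule sgn_linfty_def)
  show "uniformity = (INF e\<in>{0<..}. principal {(x::'a linfty, y). dist x y < e})"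
    by (rule uniformity_linfty_def)
  show "open S = (\<forall>x\<in>S. \<forall>\<^sub>F (x', y) in uniformity. x' = x \<longrightarrow> y \<in> S)" for S :: "'a linfty set"
    by (rule open_linfty_def)
  show "norm f = 0 \<longleftrightarrow> f = 0"
  proof transfer
    fix f :: "'a \<Rightarrow> real" assume "ae_equal f f"
    then have f: "ess_bounded f" by (simp add: ae_equal_def)
    show "ess_norm f = 0 \<longleftrightarrow> ae_equal f (\<lambda>_. 0)"
      using AE_le_ess_norm[OF f] ess_norm_le[OF f, of 0] ereal_ess_norm(2)[OF f] f
      by (auto simp: ae_equal_def ess_bounded_const)
  qed
  show "norm (f + g) \<le> norm f + norm g"
  proof transfer
    fix f g :: "'a \<Rightarrow> real" assume "ae_equal f f" "ae_equal g g"
    then have fg: "ess_bounded f" "ess_bounded g" by (simp_all add: ae_equal_def)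
    have "AE x in lebesgue. \<bar>f x + g x\<bar> \<le> ess_norm f + ess_norm g"
      using AE_le_ess_norm[OF fg(1)] AE_le_ess_norm[OF fg(2)] by eventually_elim simp
    then show "ess_norm (\<lambda>x. f x + g x) \<le> ess_norm f + ess_norm g"
      by (intro ess_norm_le ess_bounded_add fg)
  qed
  show "norm (a *\<^sub>R f) = \<bar>a\<bar> * norm f"
  proof transfer
    fix f :: "'a \<Rightarrow> real" and a assume "ae_equal f f"
    then have f: "ess_bounded f" by (simp add: ae_equal_def)
    have le: "ess_norm (\<lambda>x. c * g x) \<le> \<bar>c\<bar> * ess_norm g" if g: "ess_bounded g" for c and g :: "'a \<Rightarrow> real"
    proof -
      have "AE x in lebesgue. \<bar>c * g x\<bar> \<le> \<bar>c\<bar> * ess_norm g"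
        using AE_le_ess_norm[OF g] by eventually_elim (simp add: abs_mult mult_left_mono)
      then show ?thesis by (intro ess_norm_le ess_bounded_cmult g)
    qed
    show "ess_norm (\<lambda>x. a * f x) = \<bar>a\<bar> * ess_norm f"
    proof (cases "a = 0")
      case True
      with le[OF f, of 0] ereal_ess_norm(2)[OF ess_bounded_cmult[OF f, of 0]] show ?thesis by simp
    next
      case False
      have "ess_norm f \<le> \<bar>inverse a\<bar> * ess_norm (\<lambda>x. a * f x)"
        using le[OF ess_bounded_cmult[OF f, of a], of "inverse a"] False
        by (simp flip: mult.assoc)
      with False le[OF f, of a] show ?thesis
        by (simp add: field_simps abs_inverse)
    qed
  qed
qed

end

instantiation linfty :: (euclidean_space) "{lattice, one}"
begin

lift_definition less_eq_linfty :: "'a linfty \<Rightarrow> 'a linfty \<Rightarrow> bool"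
  is "\<lambda>f g. AE x in lebesgue. f x \<le> g x"
proof -
  fix f f' g g' :: "'a \<Rightarrow> real" assume "ae_equal f f'" "ae_equal g g'"
  then have "AE x in lebesgue. f x = f' x" "AE x in lebesgue. g x = g' x"
    by (auto simp: ae_equal_def)
  then have "AE x in lebesgue. f x \<le> g x \<longleftrightarrow> f' x \<le> g' x" by eventually_elim simp
  then show "(AE x in lebesgue. f x \<le> g x) = (AE x in lebesgue. f' x \<le> g' x)"
    by (auto elim: eventually_elim2)
qed

definition less_linfty :: "'a linfty \<Rightarrow> 'a linfty \<Rightarrow> bool"
  where "less_linfty f g \<longleftrightarrow> f \<le> g \<and> \<not> g \<le> f"

lift_definition inf_linfty :: "'a linfty \<Rightarrow> 'a linfty \<Rightarrow> 'a linfty" is "\<lambda>f g x. min (f x) (g x)"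
  unfolding ae_equal_def by (auto simp: ess_bounded_min elim: eventually_elim2)
lift_definition sup_linfty :: "'a linfty \<Rightarrow> 'a linfty \<Rightarrow> 'a linfty" is "\<lambda>f g x. max (f x) (g x)"
  unfolding ae_equal_def by (auto simp: ess_bounded_max elim: eventually_elim2)
lift_definition one_linfty :: "'a linfty" is "\<lambda>_. 1"
  by (simp add: ae_equal_def ess_bounded_const)

instance
proof
  fix f g k :: "'a linfty"
  show "f < g \<longleftrightarrow> f \<le> g \<and> \<not> g \<le> f" by (rule less_linfty_def)
  show "f \<le> f" by transfer simp
  show "f \<le> g \<Longrightarrow> g \<le> k \<Longrightarrow> f \<le> k"
    by transfer (auto elim: eventually_elim2)
  show "f \<le> g \<Longrightarrow> g \<le> f \<Longrightarrow> f = g"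
    by transfer (auto simp: ae_equal_def elim: eventually_elim2)
  show "inf f g \<le> f" "inf f g \<le> g" "f \<le> sup f g" "g \<le> sup f g" by (transfer; simp)+
  show "f \<le> g \<Longrightarrow> f \<le> k \<Longrightarrow> f \<le> inf g k"
    by transfer (auto elim: eventually_elim2)
  show "g \<le> f \<Longrightarrow> k \<le> f \<Longrightarrow> sup g k \<le> f"
    by transfer (auto elim: eventually_elim2)
qed

end

section \<open>The evolution operator\<close>

definition order_interval :: "real \<Rightarrow> 'e::{real_normed_vector, lattice, one} set"
  where "order_interval r = {v. 0 \<le> v \<and> v \<le> r *\<^sub>R 1}"

definition truncate :: "real \<Rightarrow> 'e \<Rightarrow> 'e::{real_normed_vector, lattice, one}"
  where "truncate r v = inf (sup v 0) (r *\<^sub>R 1)"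

text \<open>
  The derivative is taken within the time interval, hence is the left derivative at \<open>T\<close>.
  The library's \<^const>\<open>C1_differentiable_on\<close> would instead require two-sided
  differentiability at \<open>T\<close>.
\<close>

definition C1_within :: "real set \<Rightarrow> (real \<Rightarrow> 'e::real_normed_vector) \<Rightarrow> bool"
  where "C1_within S u \<longleftrightarrow>
    (\<exists>u'. (\<forall>t\<in>S. (u has_vector_derivative u' t) (at t within S)) \<and> continuous_on S u')"

definition evol_op ::
  "('e \<Rightarrow> 'e) \<Rightarrow> real \<Rightarrow> real \<Rightarrow> (real \<Rightarrow> 'e) \<Rightarrow> real \<Rightarrow> 'e::{real_normed_vector, lattice, one}"
  where "evol_op H T r u t = vector_derivative u (at t within {0<..T}) - H (truncate r (u t))"

end

theory Submission
  imports Defs "HOL-Library.Lattice_Algebras"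
begin

text \<open>
  The three function spaces enter only as vector lattices normed by a unit: \<open>\<parallel>f\<parallel> \<le> c\<close> holds
  if and only if \<open>- c \<le> f \<le> c\<close>. In every such space put \<open>v = u\<^sub>1 - u\<^sub>2\<close>, with positive and
  negative parts \<open>v\<^sup>+\<close> and \<open>v\<^sup>-\<close>, and \<open>D t = \<parallel>v\<^sup>+ t\<parallel>\<close>. The claim is that \<open>D\<close> vanishes.

  Let \<open>w\<^sub>i\<close> be the truncation of \<open>u\<^sub>i\<close> and \<open>m = w\<^sub>1 \<or> w\<^sub>2\<close>, which again lies in the order interval.
  Truncation is monotone and does not increase the positive part of a difference, hence
  \<open>0 \<le> m - w\<^sub>2 \<le> D\<close> and \<open>m - w\<^sub>1 \<le> v\<^sup>-\<close>. Quasi-monotonicity of \<open>H\<close>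
  applied to \<open>w\<^sub>1 \<le> m\<close> and Lipschitz continuity applied to \<open>m\<close> and \<open>w\<^sub>2\<close> give
  \<open>v' \<le> H w\<^sub>1 - H w\<^sub>2 \<le> h D + p v\<^sup>-\<close> (lemma \<open>H_truncate_diff_le\<close>).

  The term \<open>p v\<^sup>-\<close> is harmless, because it vanishes where \<open>v > 0\<close>
  (lemma \<open>pprt_le_of_le_add_pprt_uminus\<close>): comparing \<open>v t\<close> with \<open>v s\<close> for
  \<open>s < t\<close> close to \<open>t\<close> yields \<open>D t \<le> D s + (t - s) (h D t + \<epsilon>)\<close>. Since \<open>D\<close> is continuous and
  \<open>D 0 = 0\<close>, a Gronwall argument (lemma \<open>backward_Gronwall\<close>) gives \<open>D = 0\<close>. Only backward
  differences are used, so the left derivative at \<open>T\<close> suffices, and no derivative at \<open>0\<close> is needed.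
\<close>

section \<open>Vector lattices normed by a unit\<close>

text \<open>
  A vector lattice whose unit ball is the order interval \<open>[- 1, 1]\<close>. The positive part of \<open>x\<close> is
  \<^term>\<open>pprt x\<close>.
\<close>

class order_unit_space = real_normed_vector + ordered_real_vector + lattice_ab_group_add + one +
  assumes norm_le_iff_unit: "norm x \<le> c \<longleftrightarrow> - (c *\<^sub>R 1) \<le> x \<and> x \<le> c *\<^sub>R 1"

lemma le_norm_unit:
  fixes x :: "'e::order_unit_space"
  shows "x \<le> norm x *\<^sub>R 1"
  using norm_le_iff_unit[of x "norm x"] by simp

lemma unit_nonneg: "(0 :: 'e::order_unit_space) \<le> 1"
  using norm_le_iff_unit[of "0 :: 'e" 1] by simp

lemma norm_le_unitI:
  fixes x :: "'e::order_unit_space"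
  assumes "0 \<le> x" "x \<le> c *\<^sub>R 1"
  shows "norm x \<le> c"
proof -
  have "- (c *\<^sub>R 1) \<le> (0 :: 'e)" using order_trans[OF assms] by simp
  with assms(1) have "- (c *\<^sub>R 1) \<le> x" by (rule order_trans[rotated])
  then show ?thesis using assms(2) by (simp add: norm_le_iff_unit)
qed

lemma le_pprt:
  fixes x :: "'e::lattice_ab_group_add"
  shows "x \<le> pprt x"
  by (simp add: pprt_def)

lemma pprt_leI:
  fixes x :: "'e::lattice_ab_group_add"
  shows "x \<le> y \<Longrightarrow> 0 \<le> y \<Longrightarrow> pprt x \<le> y"
  by (simp add: pprt_def)

lemma pprt_le_add_norm:
  fixes x y :: "'e::order_unit_space"
  shows "pprt x \<le> pprt y + norm (x - y) *\<^sub>R 1"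
proof (rule pprt_leI)
  have "y + (x - y) \<le> pprt y + norm (x - y) *\<^sub>R 1"
    by (intro add_mono le_pprt le_norm_unit)
  then show "x \<le> pprt y + norm (x - y) *\<^sub>R 1" by simp
  show "0 \<le> pprt y + norm (x - y) *\<^sub>R 1"
    by (intro add_nonneg_nonneg scaleR_nonneg_nonneg unit_nonneg) auto
qed

lemma norm_pprt_diff_le:
  fixes x y :: "'e::order_unit_space"
  shows "norm (pprt x - pprt y) \<le> norm (x - y)"
  using pprt_le_add_norm[of x y] pprt_le_add_norm[of y x]
  by (subst norm_le_iff_unit) (auto simp: norm_minus_commute algebra_simps)

lemma continuous_on_pprt:
  fixes f :: "'a::topological_space \<Rightarrow> 'e::order_unit_space"
  assumes "continuous_on S f"
  shows "continuous_on S (\<lambda>x. pprt (f x))"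
proof -
  have "continuous_on UNIV (pprt :: 'e \<Rightarrow> 'e)"
    by (rule continuous_onI) (metis norm_pprt_diff_le dist_norm less_imp_le order_le_less_trans)
  with assms show ?thesis by (auto intro: continuous_on_compose2)
qed

text \<open>
  A summand proportional to the negative part of \<open>v\<close> may be dropped from an upper bound of \<open>v\<close>.
  This is the cancellation that makes the term \<open>p v\<^sup>-\<close> harmless.
\<close>

lemma pprt_le_of_le_add_pprt_uminus:
  fixes v K :: "'e::order_unit_space"
  assumes "v \<le> K + k *\<^sub>R pprt (- v)" "0 \<le> K" "0 \<le> k"
  shows "pprt v \<le> K"
proof -
  have neg: "pprt (- v) = pprt v - v"
    using prts[of v] by (simp add: pprt_neg algebra_simps)
  have le: "(1 + k) *\<^sub>R v \<le> K + k *\<^sub>R pprt v"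
    using assms(1) unfolding neg by (simp add: algebra_simps)
  let ?y = "inverse (1 + k) *\<^sub>R (K + k *\<^sub>R pprt v)"
  have "pprt v \<le> ?y"
  proof (rule pprt_leI)
    show "v \<le> ?y"
      using scaleR_left_mono[OF le, of "inverse (1 + k)"] assms(3) by simp
    show "0 \<le> ?y"
      using assms(2,3) by (intro scaleR_nonneg_nonneg add_nonneg_nonneg) auto
  qed
  then have "(1 + k) *\<^sub>R pprt v \<le> (1 + k) *\<^sub>R ?y"
    using assms(3) by (intro scaleR_left_mono) auto
  then show ?thesis
    using assms(3) by (simp add: scaleR_add_left)
qed

section \<open>Gronwall's inequality for backward differences\<close>

text \<open>
  A continuous function whose upper left Dini derivative is at most \<open>h D\<close> stays nonpositive if it
  starts so. The hypothesis has to hold at every \<open>t > 0\<close>, for left difference quotients only.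
\<close>

lemma backward_Gronwall:
  fixes D :: "real \<Rightarrow> real"
  assumes cont: "continuous_on {0..T} D" and D0: "D 0 \<le> 0" and h: "0 \<le> h"
    and step: "\<And>t \<epsilon>. 0 < t \<Longrightarrow> t \<le> T \<Longrightarrow> 0 < \<epsilon> \<Longrightarrow>
      \<forall>\<^sub>F s in at_left t. D t \<le> D s + (t - s) * (h * D t + \<epsilon>)"
    and t: "t \<in> {0..T}"
  shows "D t \<le> 0"
proof (rule ccontr)
  assume pos: "\<not> D t \<le> 0"
  \<comment> \<open>An exponential barrier growing faster than the rate \<open>h\<close>, which \<open>D\<close> reaches at time \<open>t\<close>.\<close>
  define \<phi> where "\<phi> s = D t * exp ((h + 1) * (s - t))" for s
  have \<phi>_pos: "\<phi> s > 0" for s using pos by (simp add: \<phi>_def)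
  have \<phi>_cont: "continuous_on {0..T} \<phi>" unfolding \<phi>_def by (intro continuous_intros)
  let ?S = "{s \<in> {0..T}. \<phi> s \<le> D s}"
  have "closed ?S"
    using \<phi>_cont cont by (intro continuous_on_closed_Collect_le) auto
  moreover have "bounded ?S" by (rule bounded_subset[OF bounded_closed_interval[of 0 T]]) auto
  ultimately have "compact ?S" by (simp add: compact_eq_bounded_closed)
  moreover have "t \<in> ?S" using t by (simp add: \<phi>_def)
  ultimately obtain t0 where t0: "t0 \<in> ?S" and first: "\<And>s. s \<in> ?S \<Longrightarrow> t0 \<le> s"
    using compact_attains_inf[of ?S] by blast
  have "t0 \<noteq> 0" using t0 D0 \<phi>_pos[of 0] by auto
  then have t0_pos: "0 < t0" "t0 \<le> T" using t0 by auto
  have before: "\<forall>\<^sub>F s in at_left t0. s < t0 \<and> 0 < s"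
    using t0_pos by (auto simp: eventually_at_left intro!: exI[of _ 0])
  have small: "\<forall>\<^sub>F s in at_left t0. (t0 - s) * h < 1"
  proof -
    have "((\<lambda>s. (t0 - s) * h) \<longlongrightarrow> (t0 - t0) * h) (at_left t0)" by (intro tendsto_intros)
    then show ?thesis by (auto dest: order_tendstoD(2)[where a = 1])
  qed
  have "(\<phi> has_real_derivative (h + 1) * \<phi> t0) (at t0 within {..<t0})"
    unfolding \<phi>_def by (auto intro!: derivative_eq_intros)
  then have "((\<lambda>s. (\<phi> s - \<phi> t0) / (s - t0)) \<longlongrightarrow> (h + 1) * \<phi> t0) (at_left t0)"
    by (simp add: has_field_derivative_iff)
  moreover have "(h + 1 / 2) * \<phi> t0 < (h + 1) * \<phi> t0" using \<phi>_pos[of t0] by simp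
  ultimately have "\<forall>\<^sub>F s in at_left t0. (h + 1 / 2) * \<phi> t0 < (\<phi> s - \<phi> t0) / (s - t0)"
    by (rule order_tendstoD(1))
  moreover have "0 < \<phi> t0 / 2" using \<phi>_pos[of t0] by simp
  note step[OF t0_pos this]
  ultimately have "\<forall>\<^sub>F s in at_left t0. False"
    using before small
  proof eventually_elim
    case (elim s)
    have "D s < \<phi> s" using first[of s] elim(3) t0_pos by force
    then have "D t0 * (1 - (t0 - s) * h) < \<phi> s + (t0 - s) * (\<phi> t0 / 2)"
      using elim(2) by (simp add: algebra_simps)
    moreover have "\<phi> t0 * (1 - (t0 - s) * h) \<le> D t0 * (1 - (t0 - s) * h)"
      using t0 elim(4) by (intro mult_right_mono) auto
    moreover have "(t0 - s) * ((h + 1 / 2) * \<phi> t0) < \<phi> t0 - \<phi> s"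
      using elim(1,3) by (simp add: field_simps)
    ultimately show False by (simp add: algebra_simps)
  qed
  then show False by (simp add: trivial_limit_at_left_real)
qed

section \<open>The comparison principle in a unit-normed vector lattice\<close>

lemma truncate_in_order_interval:
  fixes x :: "'e::order_unit_space"
  assumes "0 \<le> r"
  shows "truncate r x \<in> order_interval r"
  using assms by (simp add: truncate_def order_interval_def scaleR_nonneg_nonneg unit_nonneg)

lemma sup_in_order_interval:
  fixes x y :: "'e::order_unit_space"
  shows "x \<in> order_interval r \<Longrightarrow> y \<in> order_interval r \<Longrightarrow> sup x y \<in> order_interval r"
  by (auto simp: order_interval_def intro: le_supI1)

text \<open>Truncation is monotone and shrinks increments: the one-sided form of being 1-Lipschitz.\<close>

lemma truncate_le_add_pprt_diff:
  fixes x y :: "'e::order_unit_space"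
  shows "truncate r x \<le> truncate r y + pprt (x - y)"
proof -
  let ?c = "pprt (x - y)"
  have "x \<le> y + ?c" using le_pprt[of "x - y"] by (simp add: algebra_simps)
  moreover have "0 \<le> ?c" by simp
  ultimately have "sup x 0 \<le> sup y 0 + ?c"
    by (auto simp: add_sup_distrib_right intro: le_supI1 le_supI2)
  moreover have "r *\<^sub>R 1 \<le> r *\<^sub>R 1 + ?c" using \<open>0 \<le> ?c\<close> by (simp del: zero_le_pprt)
  ultimately show ?thesis
    by (auto simp: truncate_def add_inf_distrib_right intro: le_infI1 le_infI2)
qed

text \<open>
  The order interval need not contain \<open>x\<close> and \<open>y\<close>, and their truncations need not be comparable;
  the supremum of the truncations serves as an intermediate point.
\<close>

lemma H_truncate_diff_le:
  fixes H :: "'e::order_unit_space \<Rightarrow> 'e"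
  assumes lip: "\<forall>w\<in>order_interval r. \<forall>v\<in>order_interval r. norm (H w - H v) \<le> h * norm (w - v)"
    and mono: "\<forall>w\<in>order_interval r. \<forall>v\<in>order_interval r.
      v \<le> w \<longrightarrow> H v + p *\<^sub>R v \<le> H w + p *\<^sub>R w"
    and "0 \<le> h" "0 \<le> p" "0 \<le> r"
  shows "H (truncate r x) - H (truncate r y) \<le>
    (h * norm (pprt (x - y))) *\<^sub>R 1 + p *\<^sub>R pprt (- (x - y))"
proof -
  define a b m where "a = truncate r x" and "b = truncate r y" and "m = sup a b"
  have mem: "a \<in> order_interval r" "b \<in> order_interval r" "m \<in> order_interval r"
    using \<open>0 \<le> r\<close> by (simp_all add: a_def b_def m_def truncate_in_order_interval sup_in_order_interval)
  have ab: "a \<le> b + pprt (x - y)" "b \<le> a + pprt (y - x)"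
    unfolding a_def b_def by (rule truncate_le_add_pprt_diff)+
  have "m \<le> b + pprt (x - y)" "m \<le> a + pprt (y - x)"
    using ab by (auto simp: m_def)
  then have diffs: "m - b \<le> pprt (x - y)" "m - a \<le> pprt (y - x)"
    by (auto simp: algebra_simps)
  have "norm (m - b) \<le> norm (pprt (x - y))"
    using order_trans[OF diffs(1) le_norm_unit] by (intro norm_le_unitI) (auto simp: m_def)
  then have "norm (H m - H b) \<le> h * norm (pprt (x - y))"
    using lip mem \<open>0 \<le> h\<close> by (meson order_trans mult_left_mono)
  then have "H m - H b \<le> (h * norm (pprt (x - y))) *\<^sub>R 1"
    by (simp add: norm_le_iff_unit)
  moreover have "H a + p *\<^sub>R a \<le> H m + p *\<^sub>R m"
    using mono mem by (auto simp: m_def)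
  then have "H a - H m \<le> p *\<^sub>R (m - a)" by (simp add: algebra_simps)
  moreover have "p *\<^sub>R (m - a) \<le> p *\<^sub>R pprt (y - x)"
    using diffs(2) \<open>0 \<le> p\<close> by (rule scaleR_left_mono)
  ultimately have "(H m - H b) + (H a - H m) \<le>
      (h * norm (pprt (x - y))) *\<^sub>R 1 + p *\<^sub>R pprt (y - x)"
    by (meson add_mono order_trans)
  then show ?thesis by (simp add: a_def b_def)
qed

text \<open>
  First-order expansion at \<open>t\<close> read backward in time; only the left derivative enters, since
  the interval of differentiability may end at \<open>t\<close>.
\<close>

lemma eventually_le_backward_linear:
  fixes v :: "real \<Rightarrow> 'e::order_unit_space"
  assumes "(v has_vector_derivative v') (at t within {0<..T})" "0 < t" "t \<le> T" "0 < \<epsilon>"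
  shows "\<forall>\<^sub>F s in at_left t. v t \<le> v s + (t - s) *\<^sub>R (v' + \<epsilon> *\<^sub>R 1)"
proof -
  have "(v has_derivative (\<lambda>s. s *\<^sub>R v')) (at t within {0<..T})"
    using assms(1) by (simp add: has_vector_derivative_def)
  then obtain d where d: "d > 0"
    "\<And>s. s \<in> {0<..T} \<Longrightarrow> norm (s - t) < d \<Longrightarrow> norm (v s - v t - (s - t) *\<^sub>R v') \<le> \<epsilon> * norm (s - t)"
    using \<open>0 < \<epsilon>\<close> unfolding has_derivative_within_alt by blast
  have "\<forall>\<^sub>F s in at_left t. max 0 (t - d) < s \<and> s < t"
    using d(1) \<open>0 < t\<close> by (auto simp: eventually_at_left intro!: exI[of _ "max 0 (t - d)"])
  then show ?thesis
  proof eventually_elim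
    case (elim s)
    then have "norm (v s - v t - (s - t) *\<^sub>R v') \<le> \<epsilon> * (t - s)"
      using d(2)[of s] \<open>t \<le> T\<close> by (simp add: abs_if)
    then have "- ((\<epsilon> * (t - s)) *\<^sub>R 1) \<le> v s - v t - (s - t) *\<^sub>R v'"
      by (simp add: norm_le_iff_unit)
    then show ?case by (simp add: algebra_simps)
  qed
qed

lemma C1_within_imp_has_vector_derivative:
  "C1_within S u \<Longrightarrow> t \<in> S \<Longrightarrow>
    (u has_vector_derivative vector_derivative u (at t within S)) (at t within S)"
  unfolding C1_within_def by (meson differentiableI_vector vector_derivative_works)

theorem evol_op_comparison:
  fixes H :: "'e::order_unit_space \<Rightarrow> 'e" and u1 u2 :: "real \<Rightarrow> 'e"
  assumes lip: "\<forall>w\<in>order_interval r. \<forall>v\<in>order_interval r. norm (H w - H v) \<le> h * norm (w - v)"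
    and mono: "\<forall>w\<in>order_interval r. \<forall>v\<in>order_interval r.
      v \<le> w \<longrightarrow> H v + p *\<^sub>R v \<le> H w + p *\<^sub>R w"
    and nonneg: "0 \<le> h" "0 \<le> p" "0 \<le> r"
    and cont: "continuous_on {0..T} u1" "continuous_on {0..T} u2"
    and C1: "C1_within {0<..T} u1" "C1_within {0<..T} u2"
    and evol: "\<forall>t\<in>{0<..T}. evol_op H T r u1 t \<le> evol_op H T r u2 t"
    and init: "u1 0 \<le> u2 0" and t: "t \<in> {0..T}"
  shows "u1 t \<le> u2 t"
proof -
  define v where "v s = u1 s - u2 s" for s
  define D where "D s = norm (pprt (v s))" for s
  have "D t \<le> 0"
  proof (rule backward_Gronwall[OF _ _ nonneg(1) _ t])
    show "continuous_on {0..T} D"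
      unfolding D_def v_def by (intro continuous_intros continuous_on_pprt cont)
    show "D 0 \<le> 0" using init by (simp add: D_def v_def)
    fix t \<epsilon> :: real assume t: "0 < t" "t \<le> T" and \<epsilon>: "0 < \<epsilon>"
    define v' where "v' = vector_derivative u1 (at t within {0<..T}) - vector_derivative u2 (at t within {0<..T})"
    have deriv: "(v has_vector_derivative v') (at t within {0<..T})"
      unfolding v_def v'_def using C1 t
      by (intro has_vector_derivative_diff C1_within_imp_has_vector_derivative) auto
    have "evol_op H T r u1 t \<le> evol_op H T r u2 t" using evol t by simp
    then have "v' \<le> H (truncate r (u1 t)) - H (truncate r (u2 t))"
      by (simp add: evol_op_def v'_def algebra_simps)
    also have "\<dots> \<le> (h * D t) *\<^sub>R 1 + p *\<^sub>R pprt (- v t)"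
      using H_truncate_diff_le[OF lip mono nonneg, of "u1 t" "u2 t"] by (simp add: D_def v_def)
    finally have v'_le: "v' \<le> (h * D t) *\<^sub>R 1 + p *\<^sub>R pprt (- v t)" .
    have D_nonneg: "0 \<le> D s" for s by (simp add: D_def)
    have "\<forall>\<^sub>F s in at_left t. s < t" by (simp add: eventually_at_filter)
    with eventually_le_backward_linear[OF deriv t \<epsilon>]
    show "\<forall>\<^sub>F s in at_left t. D t \<le> D s + (t - s) * (h * D t + \<epsilon>)"
    proof eventually_elim
      case (elim s)
      let ?K = "D s + (t - s) * (h * D t + \<epsilon>)"
      have K: "0 \<le> ?K"
        using elim(2) \<epsilon> nonneg(1) D_nonneg by (intro add_nonneg_nonneg mult_nonneg_nonneg) auto
      have "v s \<le> D s *\<^sub>R 1"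
        unfolding D_def using le_pprt le_norm_unit by (rule order_trans)
      moreover have "(t - s) *\<^sub>R (v' + \<epsilon> *\<^sub>R 1) \<le>
          (t - s) *\<^sub>R ((h * D t) *\<^sub>R 1 + p *\<^sub>R pprt (- v t) + \<epsilon> *\<^sub>R 1)"
        using v'_le elim(2) by (intro scaleR_left_mono add_right_mono) auto
      ultimately have "v t \<le> D s *\<^sub>R 1 +
          (t - s) *\<^sub>R ((h * D t) *\<^sub>R 1 + p *\<^sub>R pprt (- v t) + \<epsilon> *\<^sub>R 1)"
        using elim(1) by (meson add_mono order_trans)
      also have "\<dots> = ?K *\<^sub>R 1 + ((t - s) * p) *\<^sub>R pprt (- v t)"
        by (simp add: algebra_simps)
      finally have "pprt (v t) \<le> ?K *\<^sub>R 1"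
        by (rule pprt_le_of_le_add_pprt_uminus)
          (use K elim(2) nonneg(2) in \<open>auto intro: scaleR_nonneg_nonneg unit_nonneg\<close>)
      then show "D t \<le> ?K" unfolding D_def by (intro norm_le_unitI) auto
    qed
  qed
  then have "v t \<le> 0" using le_pprt[of "v t"] by (simp add: D_def)
  then show ?thesis by (simp add: v_def)
qed

section \<open>The three function spaces\<close>

instance real :: order_unit_space
  by standard auto

text \<open>
  Linearly ordered values are required because the lattice operations on bounded continuous
  functions are built from \<^const>\<open>min\<close> and \<^const>\<open>max\<close>.
\<close>

instance bcontfun :: (topological_space, "{order_unit_space, linorder_topology}") order_unit_space
proof
  fix f g k :: "'a \<Rightarrow>\<^sub>C 'b" and a b c :: real
  show "f \<le> g \<Longrightarrow> k + f \<le> k + g" by (simp add: less_eq_bcontfun.rep_eq)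
  show "f \<le> g \<Longrightarrow> 0 \<le> a \<Longrightarrow> a *\<^sub>R f \<le> a *\<^sub>R g"
    by (simp add: less_eq_bcontfun.rep_eq scaleR_left_mono)
  show "a \<le> b \<Longrightarrow> 0 \<le> f \<Longrightarrow> a *\<^sub>R f \<le> b *\<^sub>R f"
    by (simp add: less_eq_bcontfun.rep_eq scaleR_right_mono)
  have "norm f \<le> c \<longleftrightarrow> (\<forall>x. norm (f x) \<le> c)"
    using norm_bounded[of f] norm_bound[of f c] by (meson order_trans)
  then show "norm f \<le> c \<longleftrightarrow> - (c *\<^sub>R 1) \<le> f \<and> f \<le> c *\<^sub>R 1"
    by (auto simp: less_eq_bcontfun.rep_eq one_bcontfun_def norm_le_iff_unit)
qed

instance buc :: (metric_space) order_unit_space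
proof
  fix f g k :: "'a buc" and a b c :: real
  show "f \<le> g \<Longrightarrow> k + f \<le> k + g" by transfer (rule add_left_mono)
  show "f \<le> g \<Longrightarrow> 0 \<le> a \<Longrightarrow> a *\<^sub>R f \<le> a *\<^sub>R g" by transfer (rule scaleR_left_mono)
  show "a \<le> b \<Longrightarrow> 0 \<le> f \<Longrightarrow> a *\<^sub>R f \<le> b *\<^sub>R f" by transfer (rule scaleR_right_mono)
  show "norm f \<le> c \<longleftrightarrow> - (c *\<^sub>R 1) \<le> f \<and> f \<le> c *\<^sub>R 1" by transfer (rule norm_le_iff_unit)
qed

instance linfty :: (euclidean_space) order_unit_space
proof
  fix f g k :: "'a linfty" and a b c :: real
  show "f \<le> g \<Longrightarrow> k + f \<le> k + g" by transfer simp
  show "f \<le> g \<Longrightarrow> 0 \<le> a \<Longrightarrow> a *\<^sub>R f \<le> a *\<^sub>R g"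
    by transfer (auto elim!: eventually_mono intro: mult_left_mono)
  show "a \<le> b \<Longrightarrow> 0 \<le> f \<Longrightarrow> a *\<^sub>R f \<le> b *\<^sub>R f"
    by transfer (auto elim!: eventually_mono intro: mult_right_mono)
  show "norm f \<le> c \<longleftrightarrow> - (c *\<^sub>R 1) \<le> f \<and> f \<le> c *\<^sub>R 1"
  proof transfer
    fix f :: "'a \<Rightarrow> real" and c assume "ae_equal f f"
    then have f: "ess_bounded f" by (simp add: ae_equal_def)
    have "ess_norm f \<le> c \<longleftrightarrow> (AE x in lebesgue. \<bar>f x\<bar> \<le> c)"
    proof
      show "AE x in lebesgue. \<bar>f x\<bar> \<le> c" if "ess_norm f \<le> c"
        using AE_le_ess_norm[OF f] by eventually_elim (use that in simp)
    qed (rule ess_norm_le[OF f])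
    also have "\<dots> \<longleftrightarrow> (AE x in lebesgue. - (c * 1) \<le> f x \<and> f x \<le> c * 1)"
      by (simp add: abs_le_iff conj_commute minus_le_iff)
    also have "\<dots> \<longleftrightarrow> (AE x in lebesgue. - (c * 1) \<le> f x) \<and> (AE x in lebesgue. f x \<le> c * 1)"
      by (rule AE_conj_iff)
    finally show "ess_norm f \<le> c \<longleftrightarrow>
      (AE x in lebesgue. - (c * 1) \<le> f x) \<and> (AE x in lebesgue. f x \<le> c * 1)" .
  qed
qed

section \<open>The comparison theorem\<close>

theorem theorem4p2:
  fixes h p r T :: real
  assumes "h > 0" and "p > 0" and "r > 0" and "T > 0"
  shows "(\<forall>(H :: (real ^ 'd::finite) buc \<Rightarrow> (real ^ 'd::finite) buc) (u1 :: real \<Rightarrow> (real ^ 'd::finite) buc) u2.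
      (\<forall>w\<in>order_interval r. \<forall>v\<in>order_interval r. norm (H w - H v) \<le> h * norm (w - v)) \<longrightarrow>
      (\<forall>w\<in>order_interval r. \<forall>v\<in>order_interval r.
          v \<le> w \<longrightarrow> H v + p *\<^sub>R v \<le> H w + p *\<^sub>R w) \<longrightarrow>
      continuous_on {0..T} u1 \<longrightarrow> C1_within {0<..T} u1 \<longrightarrow>
      continuous_on {0..T} u2 \<longrightarrow> C1_within {0<..T} u2 \<longrightarrow>
      (\<forall>t\<in>{0<..T}. 0 \<le> u1 t) \<longrightarrow>
      (\<forall>t\<in>{0<..T}. u2 t \<le> r *\<^sub>R 1) \<longrightarrow>
      (\<forall>t\<in>{0<..T}. evol_op H T r u1 t \<le> evol_op H T r u2 t) \<longrightarrow>
      u1 0 \<le> u2 0 \<longrightarrow>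
      (\<forall>t\<in>{0..T}. u1 t \<le> u2 t)) \<and>
    (\<forall>(H :: ((real ^ 'd) \<Rightarrow>\<^sub>C real) \<Rightarrow> ((real ^ 'd) \<Rightarrow>\<^sub>C real)) (u1 :: real \<Rightarrow> ((real ^ 'd) \<Rightarrow>\<^sub>C real)) u2.
      (\<forall>w\<in>order_interval r. \<forall>v\<in>order_interval r. norm (H w - H v) \<le> h * norm (w - v)) \<longrightarrow>
      (\<forall>w\<in>order_interval r. \<forall>v\<in>order_interval r.
          v \<le> w \<longrightarrow> H v + p *\<^sub>R v \<le> H w + p *\<^sub>R w) \<longrightarrow>
      continuous_on {0..T} u1 \<longrightarrow> C1_within {0<..T} u1 \<longrightarrow>
      continuous_on {0..T} u2 \<longrightarrow> C1_within {0<..T} u2 \<longrightarrow>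
      (\<forall>t\<in>{0<..T}. 0 \<le> u1 t) \<longrightarrow>
      (\<forall>t\<in>{0<..T}. u2 t \<le> r *\<^sub>R 1) \<longrightarrow>
      (\<forall>t\<in>{0<..T}. evol_op H T r u1 t \<le> evol_op H T r u2 t) \<longrightarrow>
      u1 0 \<le> u2 0 \<longrightarrow>
      (\<forall>t\<in>{0..T}. u1 t \<le> u2 t)) \<and>
    (\<forall>(H :: (real ^ 'd::finite) linfty \<Rightarrow> (real ^ 'd::finite) linfty) (u1 :: real \<Rightarrow> (real ^ 'd::finite) linfty) u2.
      (\<forall>w\<in>order_interval r. \<forall>v\<in>order_interval r. norm (H w - H v) \<le> h * norm (w - v)) \<longrightarrow>
      (\<forall>w\<in>order_interval r. \<forall>v\<in>order_interval r.
          v \<le> w \<longrightarrow> H v + p *\<^sub>R v \<le> H w + p *\<^sub>R w) \<longrightarrow>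
      continuous_on {0..T} u1 \<longrightarrow> C1_within {0<..T} u1 \<longrightarrow>
      continuous_on {0..T} u2 \<longrightarrow> C1_within {0<..T} u2 \<longrightarrow>
      (\<forall>t\<in>{0<..T}. 0 \<le> u1 t) \<longrightarrow>
      (\<forall>t\<in>{0<..T}. u2 t \<le> r *\<^sub>R 1) \<longrightarrow>
      (\<forall>t\<in>{0<..T}. evol_op H T r u1 t \<le> evol_op H T r u2 t) \<longrightarrow>
      u1 0 \<le> u2 0 \<longrightarrow>
      (\<forall>t\<in>{0..T}. u1 t \<le> u2 t))"
proof -
  have nonneg: "0 \<le> h" "0 \<le> p" "0 \<le> r" using assms by auto
  show ?thesis
    by (intro conjI allI impI ballI; rule evol_op_comparison[OF _ _ nonneg]; assumption)
qed

end
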